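(* There exists a compact set $K$ in $\mathbb C$ with $0\in\partial K$ and connected complement $\mathbb C\setminus K$ such that no continuous branch of $\log z$ can be defined on $K\setminus\{0\}$; that is, there is no continuous function $h:K\setminus\{0\}\to\mathbb C$ with $e^{h(z)}=z$ for every $z\in K\setminus\{0\}$. *)

theory Defs
  imports "HOL-Analysis.Analysis"
begin

end

theory Submission
  imports Defs
begin

text \<open>
  Work in logarithmic coordinates \<open>z = exp w\<close>.  For every \<open>k\<close> the set \<open>K\<close> contains a curve that
  runs from \<open>1\<close> along the positive real axis to radius \<open>exp (- k)\<close>, then around the circle of
  that radius up to an angle \<open>\<phi>\<^sub>k\<close> slightly below \<open>2\<pi>\<close>, and back out along a radius to
  \<open>p\<^sub>k = exp (\<i> \<phi>\<^sub>k)\<close>.  A branch \<open>h\<close> of the logarithm must satisfy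
  \<open>h p\<^sub>k = h 1 + \<i> \<phi>\<^sub>k\<close>; since \<open>\<phi>\<^sub>k\<close> increases to \<open>2\<pi>\<close>, we have \<open>p\<^sub>k \<longlonglongrightarrow> 1\<close> but
  \<open>h p\<^sub>k \<longlonglongrightarrow> h 1 + 2\<pi>\<i>\<close>, so \<open>h\<close> is not continuous at \<open>1\<close>.  The curves do not obstruct the
  complement, because the sector between the angles \<open>\<phi>\<^sub>k\<close> and \<open>\<phi>\<^sub>k\<^sub>+\<^sub>1\<close> is a channel leading from
  radius \<open>exp (- (k + 1))\<close> out of the unit disc.
\<close>

definition comb_angle :: "nat \<Rightarrow> real" where
  "comb_angle k = 2 * pi - inverse (real (Suc k))"

text \<open>The line \<open>Im w = 2\<pi>\<close> has the same image under \<open>exp\<close> as \<open>Im w = 0\<close>; including it makes the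
  set closed.\<close>
definition comb :: "complex set" where
  "comb = {w. Re w \<le> 0 \<and> (Im w = 0 \<or> Im w = 2 * pi \<or>
     (\<exists>k. - real k \<le> Re w \<and> Im w = comb_angle k) \<or>
     (\<exists>k. Re w = - real k \<and> 0 \<le> Im w \<and> Im w \<le> comb_angle k))}"

definition exp_comb :: "complex set" where
  "exp_comb = insert 0 (exp ` comb)"

section \<open>The angles, and the passage to logarithmic coordinates\<close>

lemma comb_angle_bounds: "0 < comb_angle k" "comb_angle k < 2 * pi" "pi < comb_angle k"
proof -
  have "inverse (real (Suc k)) \<le> 1" "0 < inverse (real (Suc k))"
    by (auto simp: field_simps)
  then show "0 < comb_angle k" "comb_angle k < 2 * pi" "pi < comb_angle k"
    using pi_gt3 unfolding comb_angle_def by linarith+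
qed

lemma comb_angle_le_iff: "comb_angle j \<le> comb_angle k \<longleftrightarrow> j \<le> k"
  by (auto simp: comb_angle_def field_simps)

lemma comb_angle_tendsto: "comb_angle \<longlonglongrightarrow> 2 * pi"
  using tendsto_diff[OF tendsto_const LIMSEQ_inverse_real_of_nat, of "2 * pi"]
  by (simp add: comb_angle_def[abs_def])

lemma comb_Im_bounds:
  assumes "w \<in> comb"
  shows "0 \<le> Im w" "Im w \<le> 2 * pi"
proof -
  have "0 \<le> comb_angle k" "comb_angle k \<le> 2 * pi" for k
    using comb_angle_bounds[of k] by auto
  then show "0 \<le> Im w" "Im w \<le> 2 * pi"
    using assms unfolding comb_def by (auto intro: order.trans)
qed

text \<open>Logarithms of one number differ by multiples of 2 pi i, and \<open>comb\<close> lies in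
  the closed strip of height 2 pi. A point of the open strip is therefore the only candidate, so
  membership can be tested in logarithmic coordinates.\<close>

lemma exp_in_exp_comb_iff:
  assumes "0 < Im w" "Im w < 2 * pi"
  shows "exp w \<in> exp_comb \<longleftrightarrow> w \<in> comb"
proof
  assume "exp w \<in> exp_comb"
  then obtain v where v: "v \<in> comb" "exp w = exp v"
    by (auto simp: exp_comb_def)
  have "\<bar>Im w - Im v\<bar> < 2 * pi"
    using comb_Im_bounds[OF v(1)] assms by linarith
  then show "w \<in> comb"
    using v exp_complex_eqI by blast
qed (auto simp: exp_comb_def)

lemma norm_exp_comb_le:
  assumes "z \<in> exp_comb"
  shows "norm z \<le> 1"
  using assms by (auto simp: exp_comb_def comb_def)

section \<open>Compactness\<close>

lemma compact_Re_Im_Times: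
  assumes "compact A" "compact B"
  shows "compact {w. Re w \<in> A \<and> Im w \<in> B}"
proof -
  have "{w. Re w \<in> A \<and> Im w \<in> B} = (\<lambda>p. Complex (fst p) (snd p)) ` (A \<times> B)"
    by (auto simp: image_iff complex_eq_iff)
  also have "compact \<dots>"
    unfolding Complex_eq
    by (intro compact_continuous_image compact_Times assms continuous_intros)
  finally show ?thesis .
qed

text \<open>Only finitely many arcs, and finitely many rays starting to the right of the cut,
  survive. All rays of index at least \<open>n\<close> span the full width, so with the limit line
  they form an interval times a convergent sequence with its limit.\<close>

lemma compact_comb_truncated: "compact (comb \<inter> {w. - real n \<le> Re w})"
proof -
  let ?C = "\<lambda>A B. {w. Re w \<in> A \<and> Im w \<in> B}"
  let ?S = "insert (2 * pi) (range (\<lambda>k. comb_angle (k + n)))"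
  have "comb \<inter> {w. - real n \<le> Re w} =
      ?C {- real n..0} {0} \<union> ?C {- real n..0} ?S \<union>
      (\<Union>k\<in>{..<n}. ?C {- real k..0} {comb_angle k}) \<union>
      (\<Union>k\<in>{..n}. ?C {- real k} {0..comb_angle k})" (is "?L = ?R")
  proof
    show "?L \<subseteq> ?R"
    proof
      fix w assume w: "w \<in> ?L"
      then have Re: "- real n \<le> Re w" "Re w \<le> 0"
        by (auto simp: comb_def)
      consider "Im w = 0" | "Im w = 2 * pi"
        | k where "- real k \<le> Re w" "Im w = comb_angle k"
        | k where "Re w = - real k" "0 \<le> Im w" "Im w \<le> comb_angle k"
        using w unfolding comb_def by auto
      then show "w \<in> ?R"
      proof cases
        case (3 k)
        show ?thesis
        proof (cases "k < n")
          case False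
          then have "Im w = comb_angle ((k - n) + n)"
            using 3 by simp
          then have "Im w \<in> ?S"
            by blast
          then show ?thesis
            using Re by simp
        qed (use 3 Re in auto)
      qed (use Re in auto)
    qed
    \<comment> \<open>Rays in the shifted range start at or to the left of the cut.\<close>
    have "- real (k + n) \<le> Re w" if "- real n \<le> Re w" for w k
      using that by simp
    then show "?R \<subseteq> ?L"
      unfolding comb_def by (fastforce simp del: of_nat_add)
  qed
  moreover have "compact ?S"
    using comb_angle_tendsto
    by (intro compact_sequence_with_limit LIMSEQ_ignore_initial_segment)
  then have "compact ?R"
    by (intro compact_Un compact_UN compact_Re_Im_Times) auto
  ultimately show ?thesis
    by simp
qed

text \<open>As \<open>comb\<close> is unbounded to the left, its image is approximated from outside:
  \<open>?T n\<close> fills in the disc of radius \<open>exp (- n)\<close>, and these discs shrink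
  to 0.\<close>

lemma compact_exp_comb: "compact exp_comb"
proof -
  let ?T = "\<lambda>n. exp ` (comb \<inter> {w. - real n \<le> Re w}) \<union> cball 0 (exp (- real n))"
  have "exp_comb = (\<Inter>n. ?T n)"
  proof
    show "exp_comb \<subseteq> (\<Inter>n. ?T n)"
      by (auto simp: exp_comb_def)
    show "(\<Inter>n. ?T n) \<subseteq> exp_comb"
    proof
      fix z assume z: "z \<in> (\<Inter>n. ?T n)"
      show "z \<in> exp_comb"
      proof (cases "z = 0")
        case False
        \<comment> \<open>For this \<open>n\<close> the filled disc misses \<open>z\<close>, so
          \<open>z\<close> comes from the truncated comb.\<close>
        obtain n :: nat where "- ln (norm z) < real n"
          using reals_Archimedean2 by blast
        then have "exp (- real n) < norm z"
          using False exp_less_cancel_iff[of "- real n" "ln (norm z)"] by simp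
        moreover have "z \<in> ?T n"
          using z by blast
        ultimately show ?thesis
          by (auto simp: exp_comb_def)
      qed (simp add: exp_comb_def)
    qed
  qed
  moreover have "closed (?T n)" for n
    by (intro closed_Un closed_cball compact_imp_closed compact_continuous_image
        compact_comb_truncated continuous_intros)
  then have "closed (\<Inter>n. ?T n)"
    by (intro closed_INT) blast
  ultimately have "closed exp_comb"
    by simp
  moreover have "bounded exp_comb"
    using norm_exp_comb_le by (auto simp: bounded_iff)
  ultimately show ?thesis
    by (simp add: compact_eq_bounded_closed)
qed

text \<open>At angle pi, below every \<open>comb_angle k\<close>, the comb contains only points of
  the arcs, whose real parts are integers. Half-integer real parts thus give points outside the set
  arbitrarily close to 0.\<close>

lemma zero_in_frontier_exp_comb: "0 \<in> frontier exp_comb"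
proof -
  have "0 \<notin> interior exp_comb"
  proof
    assume "0 \<in> interior exp_comb"
    then obtain e where e: "e > 0" "ball 0 e \<subseteq> exp_comb"
      by (auto simp: mem_interior)
    obtain n :: nat where "- ln e < real n"
      using reals_Archimedean2 by blast
    then have "exp (- (real n + 1 / 2)) < exp (ln e)"
      by (subst exp_less_cancel_iff) simp
    then have "exp (Complex (- (real n + 1 / 2)) pi) \<in> exp_comb"
      using e by (intro subsetD[OF e(2)]) simp
    then have mem: "Complex (- (real n + 1 / 2)) pi \<in> comb"
      by (subst (asm) exp_in_exp_comb_iff) auto
    have "pi \<noteq> comb_angle k" for k
      using comb_angle_bounds(3)[of k] by simp
    with mem obtain k where "- (real n + 1 / 2) = - real k"
      by (auto simp: comb_def)
    then have "real (2 * n + 1) = real (2 * k)"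
      by simp
    then show False
      unfolding of_nat_eq_iff by presburger
  qed
  moreover have "0 \<in> exp_comb"
    by (simp add: exp_comb_def)
  ultimately show ?thesis
    using closure_subset by (auto simp: frontier_def)
qed

section \<open>Connectedness of the complement, with 2 as base point\<close>

lemma connected_component_exp_comb_exp:
  assumes "connected T" "w \<in> T" "v \<in> T"
    and "\<And>u. u \<in> T \<Longrightarrow> 0 < Im u \<and> Im u < 2 * pi \<and> u \<notin> comb"
  shows "connected_component (- exp_comb) (exp w) (exp v)"
proof (rule connected_component_of_subset)
  show "connected_component (exp ` T) (exp w) (exp v)"
    unfolding connected_component_def using assms
    by (intro exI[of _ "exp ` T"]) (auto intro!: connected_continuous_image continuous_on_exp continuous_on_id)
  show "exp ` T \<subseteq> - exp_comb"
    using assms(4) exp_in_exp_comb_iff by fastforce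
qed

lemma connected_component_exp_comb_far:
  assumes "norm z > 1"
  shows "connected_component (- exp_comb) z 2"
proof -
  have "connected (- cball (0 :: complex) 1)"
    by (intro connected_complement_bounded_convex) auto
  moreover have "- cball 0 1 \<subseteq> - exp_comb"
    using norm_exp_comb_le by auto
  ultimately show ?thesis
    using assms unfolding connected_component_def
    by (intro exI[of _ "- cball 0 1"]) auto
qed

text \<open>Move horizontally to the right. An arc met on the way has index at most \<open>m\<close>
  and ends below \<open>Im w\<close>. A ray at height \<open>Im w\<close> has index above
  \<open>m\<close>, hence starts to the left of \<open>w\<close> and would contain \<open>w\<close>
  itself.\<close>

lemma connected_component_exp_comb_channel:
  assumes "w \<notin> comb" "- real (Suc m) < Re w" "comb_angle m < Im w" "Im w < 2 * pi"
  shows "connected_component (- exp_comb) (exp w) 2"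
proof -
  define T where "T = {u. Re w \<le> Re u} \<inter> ({u. Im w \<le> Im u} \<inter> {u. Im u \<le> Im w})"
  have "convex T"
    unfolding T_def by (intro convex_Int convex_halfspace_Re_ge
        convex_halfspace_Im_ge convex_halfspace_Im_le)
  \<comment> \<open>The maximum keeps \<open>v\<close> on the ray \<open>T\<close> and puts
    \<open>exp v\<close> outside the unit disc.\<close>
  moreover define v where "v = Complex (max 1 (Re w)) (Im w)"
  have "0 < Im u \<and> Im u < 2 * pi \<and> u \<notin> comb" if u: "u \<in> T" for u
  proof (intro conjI notI)
    show "0 < Im u"
      using u assms comb_angle_bounds(1)[of m] by (auto simp: T_def)
    show "Im u < 2 * pi"
      using u assms by (auto simp: T_def)
    assume c: "u \<in> comb"
    have [simp]: "Im u = Im w" and le: "Re w \<le> Re u"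
      using u by (auto simp: T_def)
    from c \<open>0 < Im u\<close> \<open>Im u < 2 * pi\<close> consider
      k where "Re u \<le> 0" "Im w = comb_angle k"
      | k where "Re u = - real k" "Im w \<le> comb_angle k"
      by (auto simp: comb_def)
    then show False
    proof cases
      case (1 k)
      then have "m < k"
        using assms(3) comb_angle_le_iff[of k m] by auto
      then have "- real k \<le> Re w"
        using assms(2) by linarith
      then show False
        using assms(1) 1 le by (auto simp: comb_def)
    next
      case (2 k)
      then have "k \<le> m"
        using le assms(2) by linarith
      then show False
        using 2 assms(3) comb_angle_le_iff[of k m] by linarith
    qed
  qed
  ultimately have "connected_component (- exp_comb) (exp w) (exp v)"
    by (intro connected_component_exp_comb_exp[of T] convex_connected) (auto simp: T_def v_def)
  moreover have "connected_component (- exp_comb) (exp v) 2"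
    by (intro connected_component_exp_comb_far) (auto simp: v_def)
  ultimately show ?thesis
    by (rule connected_component_trans)
qed

text \<open>A point not yet in a channel is first rotated, at constant radius between two
  consecutive circles, into the channel above \<open>comb_angle m\<close>. Rays reaching that radius
  have index at least \<open>Suc m\<close> and lie above this path.\<close>

lemma connected_component_exp_comb:
  assumes "z \<notin> exp_comb"
  shows "connected_component (- exp_comb) z 2"
proof (cases "norm z > 1")
  case True
  then show ?thesis
    by (rule connected_component_exp_comb_far)
next
  case False
  have "z \<noteq> 0"
    using assms by (auto simp: exp_comb_def)
  define w where "w = Complex (ln (norm z)) (Arg2pi z)"
  have zw: "z = exp w"
    using \<open>z \<noteq> 0\<close> Arg2pi_eq[of z] by (simp add: w_def Complex_eq exp_add exp_of_real)
  have notin: "w \<notin> comb"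
    using assms zw by (auto simp: exp_comb_def)
  have Re: "Re w \<le> 0"
    using False \<open>z \<noteq> 0\<close> by (simp add: w_def)
  have Im: "0 < Im w" "Im w < 2 * pi"
  proof -
    have "Im w \<noteq> 0"
      using notin Re by (auto simp: comb_def)
    then show "0 < Im w" "Im w < 2 * pi"
      using Arg2pi_ge_0[of z] Arg2pi_lt_2pi[of z] by (auto simp: w_def)
  qed
  \<comment> \<open>Index of the annulus containing \<open>z\<close>.\<close>
  define m where "m = nat \<lfloor>- Re w\<rfloor>"
  have m: "- real (Suc m) < Re w" "Re w \<le> - real m"
    using Re unfolding m_def by linarith+
  show ?thesis
  proof (cases "comb_angle m < Im w")
    case True
    then show ?thesis
      using connected_component_exp_comb_channel notin m Im zw by blast
  next
    case False
    \<comment> \<open>Otherwise \<open>w\<close> would lie on the arc of index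
      \<open>m\<close>.\<close>
    then have "Re w \<noteq> - real m"
      using notin Im Re by (auto simp: comb_def)
    then have lt: "Re w < - real m"
      using m by simp
    \<comment> \<open>The middle of the channel, strictly below the next ray.\<close>
    define y where "y = (comb_angle m + comb_angle (Suc m)) / 2"
    have y: "comb_angle m < y" "y < comb_angle (Suc m)"
      using comb_angle_le_iff[of "Suc m" m] by (auto simp: y_def)
    define T where "T = ({u. Re w \<le> Re u} \<inter> {u. Re u \<le> Re w}) \<inter> ({u. Im w \<le> Im u} \<inter> {u. Im u \<le> y})"
    define v where "v = Complex (Re w) y"
    have "convex T"
      unfolding T_def
      by (intro convex_Int convex_halfspace_Re_ge convex_halfspace_Re_le
        convex_halfspace_Im_ge convex_halfspace_Im_le)
    moreover have T: "0 < Im u \<and> Im u < 2 * pi \<and> u \<notin> comb" if u: "u \<in> T" for u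
    proof (intro conjI notI)
      have [simp]: "Re u = Re w" and le: "Im w \<le> Im u" "Im u \<le> y"
        using u by (auto simp: T_def)
      show "0 < Im u" "Im u < 2 * pi"
        using le Im y comb_angle_bounds[of "Suc m"] by linarith+
      assume "u \<in> comb"
      then consider k where "- real k \<le> Re w" "Im u = comb_angle k"
        | k where "Re w = - real k"
        using \<open>0 < Im u\<close> \<open>Im u < 2 * pi\<close> by (auto simp: comb_def)
      then show False
      proof cases
        case (1 k)
        then have "Suc m \<le> k"
          using lt by linarith
        then show False
          using 1 le y comb_angle_le_iff[of "Suc m" k] by linarith
      next
        case (2 k)
        then have "m < k" "k < Suc m"
          using lt m(1) by (simp_all del: of_nat_Suc)
        then show False
          by simp
      qed
    qed
    moreover have in_T: "w \<in> T" "v \<in> T"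
      using False y by (auto simp: T_def v_def)
    ultimately have "connected_component (- exp_comb) (exp w) (exp v)"
      by (intro connected_component_exp_comb_exp[of T] convex_connected)
    moreover have "connected_component (- exp_comb) (exp v) 2"
      using T[OF in_T(2)] m y
      by (intro connected_component_exp_comb_channel[of _ m]) (auto simp: v_def)
    ultimately show ?thesis
      unfolding zw by (rule connected_component_trans)
  qed
qed

lemma connected_Compl_exp_comb: "connected (- exp_comb)"
  unfolding connected_iff_connected_component
  by (metis ComplD connected_component_exp_comb connected_component_sym connected_component_trans)

section \<open>Branches of the logarithm along the curves\<close>

lemma log_branch_shift_constant:
  assumes "connected S" "continuous_on (exp ` S) h" "\<And>w. w \<in> S \<Longrightarrow> exp (h (exp w)) = exp w"
    and "u \<in> S" "v \<in> S"
  shows "h (exp u) - u = h (exp v) - (v :: complex)"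
proof -
  have "(\<lambda>w. h (exp w) - w) constant_on S"
  proof (rule continuous_discrete_range_constant[OF assms(1)])
    show "continuous_on S (\<lambda>w. h (exp w) - w)"
      by (intro continuous_intros continuous_on_compose2[OF assms(2)]) auto
    fix x assume x: "x \<in> S"
    \<comment> \<open>The values of \<open>h (exp w) - w\<close> are logarithms of 1, and distinct
      ones are at least 2 pi apart.\<close>
    have "2 * pi \<le> norm (h (exp y) - y - (h (exp x) - x))"
      if "y \<in> S" "h (exp y) - y \<noteq> h (exp x) - x" for y
    proof (rule ccontr)
      assume *: "\<not> 2 * pi \<le> norm (h (exp y) - y - (h (exp x) - x))"
      have "exp (h (exp y) - y) = exp (h (exp x) - x)"
        using x that assms(3) by (simp add: exp_diff)
      moreover have "\<bar>Im (h (exp y) - y) - Im (h (exp x) - x)\<bar> < 2 * pi"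
        using * abs_Im_le_cmod[of "h (exp y) - y - (h (exp x) - x)"] by simp
      ultimately show False
        using that exp_complex_eqI by blast
    qed
    then show "\<exists>e>0. \<forall>y. y \<in> S \<and> h (exp y) - y \<noteq> h (exp x) - x \<longrightarrow>
        e \<le> norm (h (exp y) - y - (h (exp x) - x))"
      by (intro exI[of _ "2 * pi"]) auto
  qed
  then show ?thesis
    using assms(4,5) by (auto simp: constant_on_def)
qed

text \<open>The curve from 1 to the tip lifts to three segments of \<open>comb\<close> from 0 to
  \<open>\<i> * comb_angle k\<close>, along which \<open>h (exp w) - w\<close> is constant.\<close>

lemma log_branch_exp_comb_tip:
  assumes "continuous_on (exp_comb - {0}) h" "\<And>z. z \<in> exp_comb - {0} \<Longrightarrow> exp (h z) = z"
  shows "h (exp (\<i> * comb_angle k)) = h 1 + \<i> * comb_angle k"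
proof -
  define A where "A = closed_segment 0 (Complex (- real k) 0)"
  define B where "B = closed_segment (Complex (- real k) 0) (Complex (- real k) (comb_angle k))"
  define C where "C = closed_segment (Complex (- real k) (comb_angle k)) (\<i> * comb_angle k)"
  let ?S = "A \<union> B \<union> C"
  have "connected ?S"
    by (intro connected_Un) (auto simp: A_def B_def C_def)
  have "A \<subseteq> comb"
    by (auto simp: A_def closed_segment_same_Im closed_segment_eq_real_ivl comb_def)
  moreover have "B \<subseteq> comb"
    using comb_angle_bounds(1)[of k]
    by (auto simp: B_def closed_segment_same_Re closed_segment_eq_real_ivl comb_def)
  moreover have "C \<subseteq> comb"
    by (auto simp: C_def closed_segment_same_Im closed_segment_eq_real_ivl comb_def)
  ultimately have sub: "exp ` ?S \<subseteq> exp_comb - {0}"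
    by (auto simp: exp_comb_def)
  have "h (exp (\<i> * comb_angle k)) - \<i> * comb_angle k = h (exp 0) - 0"
  proof (rule log_branch_shift_constant[OF \<open>connected ?S\<close>])
    show "continuous_on (exp ` ?S) h"
      using assms(1) sub by (rule continuous_on_subset)
    show "exp (h (exp w)) = exp w" if "w \<in> ?S" for w
      using assms(2) sub that by blast
  qed (auto simp: A_def C_def)
  then show ?thesis
    by (simp add: algebra_simps)
qed

theorem proposition3p1:
  shows "\<exists>K :: complex set. compact K \<and> 0 \<in> frontier K \<and> connected (- K) \<and>
    \<not> (\<exists>h :: complex \<Rightarrow> complex. continuous_on (K - {0}) h \<and> (\<forall>z \<in> K - {0}. exp (h z) = z))"
proof (intro exI conjI notI)
  show "compact exp_comb" "0 \<in> frontier exp_comb" "connected (- exp_comb)"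
    by (rule compact_exp_comb zero_in_frontier_exp_comb connected_Compl_exp_comb)+
  assume "\<exists>h. continuous_on (exp_comb - {0}) h \<and> (\<forall>z \<in> exp_comb - {0}. exp (h z) = z)"
  then obtain h where h: "continuous_on (exp_comb - {0}) h"
    "\<And>z. z \<in> exp_comb - {0} \<Longrightarrow> exp (h z) = z"
    by blast
  define p where "p = (\<lambda>k. exp (\<i> * comb_angle k))"
  have "p \<longlonglongrightarrow> exp (\<i> * of_real (2 * pi))"
    unfolding p_def by (intro tendsto_intros comb_angle_tendsto)
  then have p: "p \<longlonglongrightarrow> 1"
    by (simp add: exp_eq_polar)
  have "\<i> * comb_angle k \<in> comb" for k
    by (auto simp: comb_def)
  then have p_in: "p k \<in> exp_comb - {0}" for k
    by (auto simp: p_def exp_comb_def)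
  have "0 \<in> comb"
    by (simp add: comb_def)
  then have "1 \<in> exp_comb - {0}"
    unfolding exp_comb_def by force
  \<comment> \<open>Continuity at 1 forces this limit, while continuation along the curves yields
    one larger by 2 pi i.\<close>
  then have "(\<lambda>k. h (p k)) \<longlonglongrightarrow> h 1"
    using p_in by (intro continuous_on_tendsto_compose[OF h(1) p]) auto
  moreover have "(\<lambda>k. h 1 + \<i> * comb_angle k) \<longlonglongrightarrow> h 1 + \<i> * of_real (2 * pi)"
    by (intro tendsto_intros comb_angle_tendsto)
  then have "(\<lambda>k. h (p k)) \<longlonglongrightarrow> h 1 + \<i> * of_real (2 * pi)"
    using log_branch_exp_comb_tip[OF h] by (simp add: p_def)
  ultimately have "h 1 = h 1 + \<i> * of_real (2 * pi)"
    by (rule LIMSEQ_unique)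
  then show False
    by simp
qed

end
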